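(* Let $\Omega_1,\Omega_2\subset\mathbb{R}^n$ be closed convex sets such that $\Omega_1\cap\Omega_2$ is nonempty and unbounded, and let $I\subset\{1,\dots,n\}$ be a nonempty index set. Assume that $$N(\infty_I;\Omega_1)\cap\bigl(-N(\infty_I;\Omega_2)\bigr)=\{0\}.$$ Then: (i) $T(\infty_I;\Omega_1)\cap T(\infty_I;\Omega_2)\subset T(\infty_I;\Omega_1\cap\Omega_2)$; (ii) $N(\infty_I;\Omega_1\cap\Omega_2)\subset N(\infty_I;\Omega_1)+N(\infty_I;\Omega_2)$.
   Context: $\mathbb{R}^n$ carries the Euclidean inner product and norm. For a nonempty index set $I\subset\{1,\dots,n\}$, $\pi_I(x)=(x_i)_{i\in I}$. For a nonempty convex set $\Omega\subset\mathbb{R}^n$, the tangent cone at infinity $T(\infty_I;\Omega)$ is the set of $w\in\mathbb{R}^n$ such that for all sequences $x_k\in\Omega$ with $\|\pi_I(x_k)\|\to\infty$ and all $t_k>0$ with $t_k\to 0$ there exist $w_k\to w$ with $x_k+t_kw_k\in\Omega$ for all $k$. The normal cone at infinity is $N(\infty_I;\Omega)=\{v\mid\langle v,w\rangle\le 0\ \forall w\in T(\infty_I;\Omega)\}$. *)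

theory Defs
  imports "HOL-Analysis.Analysis" "HOL-Library.Set_Algebras"
begin

text \<open>
  The index set is a set \<open>I\<close> of elements of the index type \<open>'n\<close>. The Euclidean norm of the
  projection \<open>(x\<^sub>i)\<^sub>i\<close>, \<open>i \<in> I\<close>, is \<open>L2_set (($) x) I\<close>, the square root of the sum of the
  squares of the coordinates in \<open>I\<close>.

  If the coordinates in \<open>I\<close> are bounded on \<open>\<Omega>\<close>, no sequence satisfies the hypotheses below, so
  the tangent cone is the whole space and the normal cone is zero.
\<close>

definition tangent_cone_at_infinity :: "'n::finite set \<Rightarrow> (real ^ 'n) set \<Rightarrow> (real ^ 'n) set" where
  "tangent_cone_at_infinity I \<Omega> =
    {w. \<forall>(x :: nat \<Rightarrow> real ^ 'n) (t :: nat \<Rightarrow> real).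
          (\<forall>k. x k \<in> \<Omega>) \<longrightarrow>
          filterlim (\<lambda>k. L2_set (($) (x k)) I) at_top sequentially \<longrightarrow>
          (\<forall>k. t k > 0) \<longrightarrow>
          t \<longlonglongrightarrow> 0 \<longrightarrow>
          (\<exists>u :: nat \<Rightarrow> real ^ 'n. u \<longlonglongrightarrow> w \<and> (\<forall>k. x k + t k *\<^sub>R u k \<in> \<Omega>))}"

definition normal_cone_at_infinity :: "'n::finite set \<Rightarrow> (real ^ 'n) set \<Rightarrow> (real ^ 'n) set" where
  "normal_cone_at_infinity I \<Omega> = {v. \<forall>w \<in> tangent_cone_at_infinity I \<Omega>. v \<bullet> w \<le> 0}"

end

theory Submission
  imports Defs
begin

text \<open>
  The assumption on the normal cones is dual to \<open>T\<^sub>1 - T\<^sub>2 = UNIV\<close> for the tangent cones. This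
  surjectivity makes the difference of the admissible directions of the two sets contain the origin
  along every sequence going to infinity, which gives (i); it also provides the constraint
  qualification for splitting the polar of \<open>T\<^sub>1 \<inter> T\<^sub>2\<close>, which together with (i) gives (ii).
\<close>

section \<open>Convex cones and separation\<close>

text \<open>Apply separation from the origin to the convex set of differences \<open>b - a\<close>.
  Empty sets are allowed, so it applies at every index of a sequence of sets; the unit normalization
  lets the separating vectors be passed to a nonzero limit.\<close>

lemma separating_unit_vector:
  fixes A B :: "'a::euclidean_space set"
  assumes "convex A" "convex B" "A \<inter> B = {}"
  obtains v where "norm v = 1" "\<And>a b. a \<in> A \<Longrightarrow> b \<in> B \<Longrightarrow> v \<bullet> a \<le> v \<bullet> b"
proof -
  define D where "D = (\<Union>b\<in>B. \<Union>a\<in>A. {b - a})"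
  have D: "b - a \<in> D" if "a \<in> A" "b \<in> B" for a b
    using that by (auto simp: D_def)
  have "convex D"
    unfolding D_def using assms(2,1) by (rule convex_differences)
  moreover have "0 \<notin> D"
    using assms(3) by (auto simp: D_def)
  ultimately obtain v where v: "v \<noteq> 0" "\<forall>x\<in>D. 0 \<le> v \<bullet> x"
    using separating_hyperplane_set_0[of D] by blast
  have "v \<bullet> a \<le> v \<bullet> b" if "a \<in> A" "b \<in> B" for a b
    using bspec[OF v(2) D[OF that]] by (simp add: inner_diff_right)
  then show ?thesis
    using v(1) by (intro that[of "sgn v"])
      (auto simp: norm_sgn sgn_div_norm intro!: divide_right_mono)
qed

lemma convex_cone_differences:
  assumes "convex_cone A" "convex_cone B"
  shows "convex_cone {a - b |a b. a \<in> A \<and> b \<in> B}"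
proof -
  have "(\<lambda>p. fst p - snd p) ` (A \<times> B) = {a - b |a b. a \<in> A \<and> b \<in> B}"
    by force
  moreover have "convex_cone (A \<times> B)"
    using assms by (auto simp: convex_cone_iff zero_prod_def)
  moreover have "linear (\<lambda>p. fst p - snd p :: 'a)"
    by (auto intro!: linearI simp: algebra_simps)
  ultimately show ?thesis
    using convex_cone_linear_image by metis
qed

text \<open>In finite dimension a missing point can be weakly separated from any convex set, closed
  or not. This matters because a difference of two cones can fail to be closed.\<close>

lemma convex_cone_eq_UNIV:
  fixes C :: "'a::euclidean_space set"
  assumes C: "convex_cone C" and polar: "\<And>v. (\<And>c. c \<in> C \<Longrightarrow> v \<bullet> c \<le> 0) \<Longrightarrow> v = 0"
  shows "C = UNIV"
proof (rule ccontr)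
  assume "C \<noteq> UNIV"
  then obtain y where "y \<notin> C" by blast
  then have "C \<inter> {y} = {}" by blast
  moreover have "convex C" using C by (simp add: convex_cone_def)
  ultimately obtain v where v: "norm v = 1" "\<And>c. c \<in> C \<Longrightarrow> v \<bullet> c \<le> v \<bullet> y"
    using separating_unit_vector[of C "{y}"] by (metis convex_singleton singletonI)
  \<comment> \<open>A linear functional bounded above on a cone is nonpositive there: scaling a
    point with positive value by \<open>r\<close> would exceed the bound
    \<open>v \<bullet> y\<close>.\<close>
  have "v \<bullet> c \<le> 0" if "c \<in> C" for c
  proof (rule ccontr)
    assume "\<not> v \<bullet> c \<le> 0"
    then have pos: "v \<bullet> c > 0" by simp
    define r where "r = (\<bar>v \<bullet> y\<bar> + 1) / (v \<bullet> c)"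
    have r: "r > 0" "r * (v \<bullet> c) > v \<bullet> y"
      using pos by (auto simp: r_def intro!: divide_pos_pos)
    then have "r *\<^sub>R c \<in> C"
      using C that convex_cone_scaleR by fastforce
    then show False using v(2) r(2) by fastforce
  qed
  then show False using polar v(1) by force
qed

text \<open>
  The multiplier is obtained by separating the origin from the convex set
  \<open>{(a - b, s). s < v \<bullet> b}\<close>; the assumption \<open>A - B = UNIV\<close> makes the hyperplane non-vertical.
\<close>

lemma polar_Int_decomposition:
  fixes A B :: "'a::euclidean_space set"
  assumes A: "convex_cone A" and B: "convex_cone B"
    and diff: "{a - b |a b. a \<in> A \<and> b \<in> B} = UNIV"
    and v: "\<And>w. w \<in> A \<inter> B \<Longrightarrow> v \<bullet> w \<le> 0"
  obtains y where "\<And>a. a \<in> A \<Longrightarrow> y \<bullet> a \<le> 0" "\<And>b. b \<in> B \<Longrightarrow> (v - y) \<bullet> b \<le> 0"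
proof -
  define S where "S = {(a - b, s) |a b s. a \<in> A \<and> b \<in> B \<and> s < v \<bullet> b}"
  have S: "(a - b, s) \<in> S" if "a \<in> A" "b \<in> B" "s < v \<bullet> b" for a b s
    using that S_def by blast
  \<comment> \<open>The substitution \<open>r = v \<bullet> b - s\<close> turns the strict
    inequality into the factor \<open>r > 0\<close>, so \<open>S\<close> is a linear image of a
    convex product.\<close>
  have S_image: "S = (\<lambda>(a, b, r). (a - b, v \<bullet> b - r)) ` (A \<times> B \<times> {0<..})"
  proof (intro subset_antisym subsetI)
    fix p assume "p \<in> S"
    then obtain a b s where "p = (a - b, s)" "a \<in> A" "b \<in> B" "s < v \<bullet> b"
      by (auto simp: S_def)
    then show "p \<in> (\<lambda>(a, b, r). (a - b, v \<bullet> b - r)) ` (A \<times> B \<times> {0<..})"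
      by (intro image_eqI[of _ _ "(a, b, v \<bullet> b - s)"]) auto
  next
    fix p assume "p \<in> (\<lambda>(a, b, r). (a - b, v \<bullet> b - r)) ` (A \<times> B \<times> {0<..})"
    then obtain a b r where "p = (a - b, v \<bullet> b - r)" "a \<in> A" "b \<in> B" "r > 0"
      by auto
    then show "p \<in> S" using S[of a b "v \<bullet> b - r"] by simp
  qed
  moreover have "convex (A \<times> B \<times> {0::real<..})"
    using A B by (intro convex_Times) (auto simp: convex_cone_def)
  moreover have "linear (\<lambda>(a, b, r). (a - b, v \<bullet> b - r))"
    by (intro linearI) (auto simp: inner_add_right algebra_simps)
  ultimately have "convex S"
    unfolding S_image by (intro convex_linear_image)
  \<comment> \<open>A zero first component forces \<open>a = b\<close>, a point of
    \<open>A \<inter> B\<close>, so the second component is below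
    \<open>v \<bullet> b \<le> 0\<close>.\<close>
  moreover have "0 \<notin> S"
    using v by (fastforce simp: S_def zero_prod_def)
  ultimately obtain z where z: "z \<noteq> 0" "\<forall>x\<in>S. 0 \<le> z \<bullet> x"
    using separating_hyperplane_set_0 by blast
  obtain y \<mu> where z_eq: "z = (y, \<mu>)" by force
  have sep: "0 \<le> y \<bullet> (a - b) + \<mu> * s" if "a \<in> A" "b \<in> B" "s < v \<bullet> b" for a b s
    using z(2) S[OF that] z_eq by auto
  have "0 \<le> \<mu> * (-1)"
    using sep[of 0 0 "-1"] A B by (simp add: convex_cone_contains_0)
  moreover have "\<mu> \<noteq> 0"
  proof
    assume "\<mu> = 0"
    \<comment> \<open>With \<open>\<mu> = 0\<close> the functional \<open>y\<close> is nonnegative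
      on all differences; testing it on \<open>- y\<close> forces \<open>y = 0\<close>.\<close>
    obtain a b where "a \<in> A" "b \<in> B" "- y = a - b"
      using diff by blast
    then have "0 \<le> y \<bullet> (- y)"
      using sep[of a b "v \<bullet> b - 1"] \<open>\<mu> = 0\<close> by simp
    then have "y \<bullet> y = 0"
      using inner_ge_zero[of y] unfolding inner_minus_right by linarith
    then have "y = 0"
      unfolding inner_eq_zero_iff .
    then show False
      using z(1) z_eq \<open>\<mu> = 0\<close> by (simp add: zero_prod_def)
  qed
  ultimately have \<mu>: "\<mu> < 0" by simp
  \<comment> \<open>The limit s \<rightarrow> \<open>v \<bullet> b\<close> in \<open>sep\<close>:
    since \<open>\<mu> < 0\<close>, the value \<open>v \<bullet> b + e / \<mu>\<close> is admissible
    and costs exactly \<open>e\<close>.\<close>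
  have lim: "0 \<le> y \<bullet> (a - b) + \<mu> * (v \<bullet> b)" if "a \<in> A" "b \<in> B" for a b
  proof (rule field_le_epsilon)
    fix e :: real assume "e > 0"
    then have "v \<bullet> b + e / \<mu> < v \<bullet> b"
      using \<mu> by (simp add: divide_pos_neg)
    from sep[OF that this] have "0 \<le> y \<bullet> (a - b) + \<mu> * (v \<bullet> b + e / \<mu>)" .
    also have "\<mu> * (v \<bullet> b + e / \<mu>) = \<mu> * (v \<bullet> b) + e"
      using \<mu> by (simp add: distrib_left)
    finally show "0 \<le> y \<bullet> (a - b) + \<mu> * (v \<bullet> b) + e"
      by (simp only: add.assoc)
  qed
  \<comment> \<open>The multiplier is \<open>y /\<^sub>R \<mu>\<close>. Setting
    \<open>b = 0\<close>, then \<open>a = 0\<close>, in \<open>lim\<close> and dividing by the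
    negative \<open>\<mu>\<close> gives the two polar conditions.\<close>
  have "(y /\<^sub>R \<mu>) \<bullet> a \<le> 0" if "a \<in> A" for a
  proof -
    have "0 \<le> y \<bullet> a"
      using lim[OF that convex_cone_contains_0[OF B]] by simp
    then show ?thesis
      using \<mu> unfolding inner_scaleR_left by (intro mult_nonpos_nonneg) auto
  qed
  moreover have "(v - y /\<^sub>R \<mu>) \<bullet> b \<le> 0" if "b \<in> B" for b
  proof -
    have "0 \<le> \<mu> * (v \<bullet> b) - y \<bullet> b"
      using lim[OF convex_cone_contains_0[OF A] that] by simp
    then have "(\<mu> * (v \<bullet> b) - y \<bullet> b) / \<mu> \<le> 0"
      using \<mu> by (rule divide_nonneg_neg)
    also have "(\<mu> * (v \<bullet> b) - y \<bullet> b) / \<mu> = v \<bullet> b - y \<bullet> b / \<mu>"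
      using \<mu> by (simp add: diff_divide_distrib)
    also have "y \<bullet> b / \<mu> = (y /\<^sub>R \<mu>) \<bullet> b"
      unfolding inner_scaleR_left by (rule divide_inverse_commute)
    finally show ?thesis
      unfolding inner_diff_left .
  qed
  ultimately show ?thesis using that by blast
qed

section \<open>Tangent cones at infinity\<close>

lemma L2_set_nth_le_norm: "L2_set (($) x) I \<le> norm (x :: real ^ 'n)"
proof -
  have "L2_set (($) x) I \<le> L2_set (($) x) UNIV"
    unfolding L2_set_def by (intro real_sqrt_le_mono sum_mono2) auto
  then show ?thesis
    by (simp add: norm_vec_def L2_set_def)
qed

text \<open>Reverse triangle inequality for the seminorm, which is dominated by the norm. It allows
  a perturbed sequence to serve again as a base sequence going to infinity.\<close>

lemma filterlim_L2_set_nth_add_at_top: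
  fixes x y :: "nat \<Rightarrow> real ^ 'n"
  assumes x: "filterlim (\<lambda>k. L2_set (($) (x k)) I) at_top sequentially" and y: "y \<longlonglongrightarrow> 0"
  shows "filterlim (\<lambda>k. L2_set (($) (x k + y k)) I) at_top sequentially"
proof -
  have "(\<lambda>k. - norm (y k)) \<longlonglongrightarrow> 0"
    using tendsto_minus[OF tendsto_norm_zero[OF y]] by simp
  then have "filterlim (\<lambda>k. - norm (y k) + L2_set (($) (x k)) I) at_top sequentially"
    using x by (rule filterlim_tendsto_add_at_top)
  moreover have "- norm (y k) + L2_set (($) (x k)) I \<le> L2_set (($) (x k + y k)) I" for k
  proof -
    have "L2_set (($) (x k)) I = L2_set (\<lambda>i. (x k + y k) $ i + (- y k) $ i) I"
      by simp
    also have "\<dots> \<le> L2_set (($) (x k + y k)) I + L2_set (($) (- y k)) I"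
      by (rule L2_set_triangle_ineq)
    finally show ?thesis
      using L2_set_nth_le_norm[of "- y k" I] by simp
  qed
  ultimately show ?thesis
    by (auto intro: filterlim_at_top_mono)
qed

lemma tangent_cone_at_infinityD:
  assumes "w \<in> tangent_cone_at_infinity I \<Omega>"
    and "\<And>k. x k \<in> \<Omega>" and "filterlim (\<lambda>k. L2_set (($) (x k)) I) at_top sequentially"
    and "\<And>k. t k > 0" and "t \<longlonglongrightarrow> 0"
  obtains u where "u \<longlonglongrightarrow> w" "\<And>k. x k + t k *\<^sub>R u k \<in> \<Omega>"
  using assms unfolding tangent_cone_at_infinity_def by blast

text \<open>The definition ranges over all base sequences, so \<open>b\<close> can be applied at the
  points already shifted along \<open>a\<close>, with the same step sizes.\<close>

lemma tangent_cone_at_infinity_add: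
  assumes a: "a \<in> tangent_cone_at_infinity I \<Omega>" and b: "b \<in> tangent_cone_at_infinity I \<Omega>"
  shows "a + b \<in> tangent_cone_at_infinity I \<Omega>"
  unfolding tangent_cone_at_infinity_def
proof (intro CollectI allI impI)
  fix x :: "nat \<Rightarrow> real ^ 'a" and t :: "nat \<Rightarrow> real"
  assume x: "\<forall>k. x k \<in> \<Omega>" "filterlim (\<lambda>k. L2_set (($) (x k)) I) at_top sequentially"
    and t: "\<forall>k. t k > 0" "t \<longlonglongrightarrow> 0"
  obtain u where u: "u \<longlonglongrightarrow> a" "\<And>k. x k + t k *\<^sub>R u k \<in> \<Omega>"
    using tangent_cone_at_infinityD[OF a _ x(2) _ t(2)] x(1) t(1) by blast
  have "(\<lambda>k. t k *\<^sub>R u k) \<longlonglongrightarrow> 0"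
    using tendsto_scaleR[OF t(2) u(1)] by simp
  with x(2) have "filterlim (\<lambda>k. L2_set (($) (x k + t k *\<^sub>R u k)) I) at_top sequentially"
    by (rule filterlim_L2_set_nth_add_at_top)
  then obtain u' where u': "u' \<longlonglongrightarrow> b" "\<And>k. x k + t k *\<^sub>R u k + t k *\<^sub>R u' k \<in> \<Omega>"
    using tangent_cone_at_infinityD[OF b, of "\<lambda>k. x k + t k *\<^sub>R u k" t] u(2) t by blast
  show "\<exists>u. u \<longlonglongrightarrow> a + b \<and> (\<forall>k. x k + t k *\<^sub>R u k \<in> \<Omega>)"
    using u' tendsto_add[OF u(1) u'(1)]
    by (intro exI[of _ "\<lambda>k. u k + u' k"]) (auto simp: algebra_simps)
qed

lemma tangent_cone_at_infinity_scaleR: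
  assumes a: "a \<in> tangent_cone_at_infinity I \<Omega>" and "c \<ge> 0"
  shows "c *\<^sub>R a \<in> tangent_cone_at_infinity I \<Omega>"
\<comment> \<open>For \<open>c > 0\<close> the factor is absorbed into the step sizes
  \<open>t k * c\<close>; these would not be positive for \<open>c = 0\<close>.\<close>
proof (cases "c = 0")
  case True
  then show ?thesis
    unfolding tangent_cone_at_infinity_def by (auto intro!: exI[of _ "\<lambda>_. 0"])
next
  case False
  then have c: "c > 0" using assms by simp
  show ?thesis
    unfolding tangent_cone_at_infinity_def
  proof (intro CollectI allI impI)
    fix x :: "nat \<Rightarrow> real ^ 'a" and t :: "nat \<Rightarrow> real"
    assume x: "\<forall>k. x k \<in> \<Omega>" "filterlim (\<lambda>k. L2_set (($) (x k)) I) at_top sequentially"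
      and t: "\<forall>k. t k > 0" "t \<longlonglongrightarrow> 0"
    have "(\<lambda>k. t k * c) \<longlonglongrightarrow> 0" "\<And>k. t k * c > 0"
      using t c tendsto_mult_right[OF t(2), of c] by auto
    then obtain u where u: "u \<longlonglongrightarrow> a" "\<And>k. x k + (t k * c) *\<^sub>R u k \<in> \<Omega>"
      using tangent_cone_at_infinityD[OF a _ x(2), of "\<lambda>k. t k * c"] x(1) by blast
    show "\<exists>u. u \<longlonglongrightarrow> c *\<^sub>R a \<and> (\<forall>k. x k + t k *\<^sub>R u k \<in> \<Omega>)"
      using u tendsto_scaleR[OF tendsto_const u(1), of c]
      by (intro exI[of _ "\<lambda>k. c *\<^sub>R u k"]) auto
  qed
qed

lemma convex_cone_tangent_cone_at_infinity: "convex_cone (tangent_cone_at_infinity I \<Omega>)"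
proof -
  have "0 \<in> tangent_cone_at_infinity I \<Omega>"
    unfolding tangent_cone_at_infinity_def by (auto intro!: exI[of _ "\<lambda>_. 0"])
  then show ?thesis
    by (simp add: convex_cone_iff tangent_cone_at_infinity_add tangent_cone_at_infinity_scaleR)
qed

text \<open>Negating the definition only excludes convergent choices of directions. Directions to
  closest points are the best choice, so their failure to converge to \<open>w\<close> excludes a
  whole ball of fixed radius along a subsequence.\<close>

lemma not_in_tangent_cone_at_infinityE:
  fixes \<Omega> :: "(real ^ 'n) set"
  assumes "closed \<Omega>" and w: "w \<notin> tangent_cone_at_infinity I \<Omega>"
  obtains x t e where "\<And>k. x k \<in> \<Omega>"
    and "filterlim (\<lambda>k. L2_set (($) (x k)) I) at_top sequentially"
    and "\<And>k. t k > 0" and "t \<longlonglongrightarrow> 0" and "e > 0"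
    and "\<And>k m. m \<in> cball w e \<Longrightarrow> x k + t k *\<^sub>R m \<notin> \<Omega>"
proof -
  obtain x t where x: "\<And>k. x k \<in> \<Omega>" "filterlim (\<lambda>k. L2_set (($) (x k)) I) at_top sequentially"
    and t: "\<And>k. t k > 0" "t \<longlonglongrightarrow> 0"
    and no: "\<not> (\<exists>u. u \<longlonglongrightarrow> w \<and> (\<forall>k. x k + t k *\<^sub>R u k \<in> \<Omega>))"
    using w unfolding tangent_cone_at_infinity_def by blast
  define u where "u k = (closest_point \<Omega> (x k + t k *\<^sub>R w) - x k) /\<^sub>R t k" for k
  have u_eq: "x k + t k *\<^sub>R u k = closest_point \<Omega> (x k + t k *\<^sub>R w)" for k
    using t(1)[of k] by (simp add: u_def)
  moreover have "\<Omega> \<noteq> {}" using x(1) by blast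
  ultimately have u_in: "x k + t k *\<^sub>R u k \<in> \<Omega>" for k
    using assms(1) closest_point_in_set by metis
  \<comment> \<open>Scaling by \<open>t k\<close> and translating by \<open>x k\<close> carries the
    closest point property over to directions: \<open>u k\<close> is an admissible direction nearest
    to \<open>w\<close>.\<close>
  have closest: "dist (u k) w \<le> dist m w" if "x k + t k *\<^sub>R m \<in> \<Omega>" for k m
  proof -
    have *: "dist (x k + t k *\<^sub>R w) (x k + t k *\<^sub>R m') = t k * dist m' w" for m'
      using t(1)[of k] by (simp add: dist_norm norm_minus_commute flip: scaleR_diff_right)
    have "dist (x k + t k *\<^sub>R w) (x k + t k *\<^sub>R u k) \<le> dist (x k + t k *\<^sub>R w) (x k + t k *\<^sub>R m)"
      unfolding u_eq using assms(1) that by (rule closest_point_le)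
    then show ?thesis
      unfolding * using t(1)[of k] by simp
  qed
  have "\<not> u \<longlonglongrightarrow> w" using no u_in by blast
  then obtain e where e: "e > 0" "\<exists>\<^sub>F k in sequentially. e \<le> dist (u k) w"
    unfolding tendsto_iff by (auto simp: not_eventually not_less)
  then have "infinite {k. e \<le> dist (u k) w}"
    by (simp add: frequently_cofinite flip: cofinite_eq_sequentially)
  then obtain r :: "nat \<Rightarrow> nat" where r: "strict_mono r" "\<And>k. e \<le> dist (u (r k)) w"
    using infinite_enumerate by blast
  show ?thesis
  \<comment> \<open>Admissible directions have distance at least \<open>e\<close> from
    \<open>w\<close>, with equality possible; halving the radius keeps the closed ball clear of
    them.\<close>
  proof (rule that[of "x \<circ> r" "t \<circ> r" "e / 2"])
    show "filterlim (\<lambda>k. L2_set (($) ((x \<circ> r) k)) I) at_top sequentially"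
      using filterlim_compose[OF x(2) filterlim_subseq[OF r(1)]] by simp
    show "(t \<circ> r) \<longlonglongrightarrow> 0"
      using t(2) r(1) by (rule LIMSEQ_subseq_LIMSEQ)
    show "(x \<circ> r) k + (t \<circ> r) k *\<^sub>R m \<notin> \<Omega>" if "m \<in> cball w (e / 2)" for k m
      using closest[of "r k" m] r(2)[of k] that e(1) by (auto simp: dist_commute)
  qed (use x t e in auto)
qed

lemma convex_admissible_directions:
  fixes w x :: "'a::real_normed_vector"
  assumes "convex \<Omega>"
  shows "convex {m \<in> cball w e. x + t *\<^sub>R m \<in> \<Omega>}"
proof -
  have eq: "{m \<in> cball w e. x + t *\<^sub>R m \<in> \<Omega>} = cball w e \<inter> (\<lambda>m. t *\<^sub>R m) -` ((\<lambda>y. - x + y) ` \<Omega>)"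
    by (force simp: image_iff algebra_simps)
  have "convex ((\<lambda>m. t *\<^sub>R m) -` ((\<lambda>y. - x + y) ` \<Omega>))"
    using assms by (intro convex_linear_vimage convex_translation) (auto intro: linearI simp: algebra_simps)
  then show ?thesis
    unfolding eq by (intro convex_Int convex_cball)
qed

text \<open>
  If no direction close to \<open>w\<close> stays in both sets, unit vectors separate the two sets of admissible
  directions. A limit \<open>v\<close> of these unit vectors has the form \<open>a - b\<close>, and comparing the directions
  \<open>w + s a\<close> and \<open>w + s b\<close> yields \<open>s (v \<bullet> v) \<le> 0\<close>.
\<close>

lemma tangent_cone_at_infinity_Int:
  fixes \<Omega>\<^sub>1 \<Omega>\<^sub>2 :: "(real ^ 'n) set" and I :: "'n set"
  defines "T\<^sub>1 \<equiv> tangent_cone_at_infinity I \<Omega>\<^sub>1" and "T\<^sub>2 \<equiv> tangent_cone_at_infinity I \<Omega>\<^sub>2"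
  assumes closed: "closed \<Omega>\<^sub>1" "closed \<Omega>\<^sub>2" and convex: "convex \<Omega>\<^sub>1" "convex \<Omega>\<^sub>2"
    and diff: "{a - b |a b. a \<in> T\<^sub>1 \<and> b \<in> T\<^sub>2} = UNIV"
  shows "T\<^sub>1 \<inter> T\<^sub>2 \<subseteq> tangent_cone_at_infinity I (\<Omega>\<^sub>1 \<inter> \<Omega>\<^sub>2)"
proof
  fix w assume w: "w \<in> T\<^sub>1 \<inter> T\<^sub>2"
  show "w \<in> tangent_cone_at_infinity I (\<Omega>\<^sub>1 \<inter> \<Omega>\<^sub>2)"
  proof (rule ccontr)
    assume "w \<notin> tangent_cone_at_infinity I (\<Omega>\<^sub>1 \<inter> \<Omega>\<^sub>2)"
    then obtain x t e where x: "\<And>k. x k \<in> \<Omega>\<^sub>1 \<inter> \<Omega>\<^sub>2"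
        "filterlim (\<lambda>k. L2_set (($) (x k)) I) at_top sequentially"
      and t: "\<And>k. t k > 0" "t \<longlonglongrightarrow> 0" and e: "e > 0"
      and no: "\<And>k m. m \<in> cball w e \<Longrightarrow> x k + t k *\<^sub>R m \<notin> \<Omega>\<^sub>1 \<inter> \<Omega>\<^sub>2"
      by (rule not_in_tangent_cone_at_infinityE[rotated]) (use closed in auto)
    have w1: "w \<in> tangent_cone_at_infinity I \<Omega>\<^sub>1" and w2: "w \<in> tangent_cone_at_infinity I \<Omega>\<^sub>2"
      using w by (auto simp: T\<^sub>1_def T\<^sub>2_def)
    have x1: "x k \<in> \<Omega>\<^sub>1" and x2: "x k \<in> \<Omega>\<^sub>2" for k
      using x(1)[of k] by auto
    define A where "A k = {m \<in> cball w e. x k + t k *\<^sub>R m \<in> \<Omega>\<^sub>1}" for k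
    define B where "B k = {m \<in> cball w e. x k + t k *\<^sub>R m \<in> \<Omega>\<^sub>2}" for k
    have "\<exists>v. norm v = 1 \<and> (\<forall>a\<in>A k. \<forall>b\<in>B k. v \<bullet> a \<le> v \<bullet> b)" for k
    proof -
      have "A k \<inter> B k = {}" using no[of _ k] by (auto simp: A_def B_def)
      moreover have "convex (A k)" "convex (B k)"
        using convex unfolding A_def B_def by (simp_all only: convex_admissible_directions)
      ultimately obtain v where "norm v = 1" "\<And>a b. a \<in> A k \<Longrightarrow> b \<in> B k \<Longrightarrow> v \<bullet> a \<le> v \<bullet> b"
        using separating_unit_vector[of "A k" "B k"] by blast
      then show ?thesis by blast
    qed
    then have "\<exists>v. \<forall>k. norm (v k) = 1 \<and> (\<forall>a\<in>A k. \<forall>b\<in>B k. v k \<bullet> a \<le> v k \<bullet> b)"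
      by (intro choice allI)
    then obtain v where v: "\<And>k. norm (v k) = 1" "\<And>k a b. a \<in> A k \<Longrightarrow> b \<in> B k \<Longrightarrow> v k \<bullet> a \<le> v k \<bullet> b"
      by blast
    have "\<forall>k. v k \<in> sphere 0 1" using v(1) by simp
    \<comment> \<open>Compactness of the sphere keeps the limit \<open>v0\<close> of unit length,
      hence nonzero.\<close>
    then obtain v0 r where v0: "v0 \<in> sphere 0 1" and r: "strict_mono r" "(v \<circ> r) \<longlonglongrightarrow> v0"
      using compact_sphere[of "0 :: real ^ 'n" 1] by (elim seq_compactE[OF compact_imp_seq_compact]) auto
    obtain a b where ab: "v0 = a - b" "a \<in> T\<^sub>1" "b \<in> T\<^sub>2"
      using diff by blast
    \<comment> \<open>Small enough that \<open>w + s *\<^sub>R a\<close> and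
      \<open>w + s *\<^sub>R b\<close> both lie in the open ball of radius \<open>e\<close> around
      \<open>w\<close>; the summand 1 keeps the denominator positive.\<close>
    define s where "s = e / (1 + norm a + norm b)"
    have s: "s > 0" using e by (auto simp: s_def intro!: divide_pos_pos add_pos_nonneg)
    have "s * (1 + norm a + norm b) = e"
      using norm_ge_zero[of a] norm_ge_zero[of b] by (simp add: s_def add_nonneg_eq_0_iff)
    then have s_small: "s * norm a < e" "s * norm b < e"
      using s by (auto simp: distrib_left add_pos_nonneg)
    \<comment> \<open>Because the tangent cone is a convex cone, it contains
      \<open>w + s *\<^sub>R c\<close>. This point is interior to the ball, so directions realizing
      it are eventually in the ball.\<close>
    have eventually_in: "\<exists>p. p \<longlonglongrightarrow> w + s *\<^sub>R c \<and>
        (\<forall>\<^sub>F k in sequentially. p k \<in> cball w e \<and> x k + t k *\<^sub>R p k \<in> \<Omega>)"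
      if c: "c \<in> tangent_cone_at_infinity I \<Omega>" "s * norm c < e"
        and w_in: "w \<in> tangent_cone_at_infinity I \<Omega>" and x_in: "\<And>k. x k \<in> \<Omega>" for c \<Omega>
    proof -
      have "w + s *\<^sub>R c \<in> tangent_cone_at_infinity I \<Omega>"
        using c(1) w_in s by (intro tangent_cone_at_infinity_add tangent_cone_at_infinity_scaleR) auto
      then obtain p where p: "p \<longlonglongrightarrow> w + s *\<^sub>R c" "\<And>k. x k + t k *\<^sub>R p k \<in> \<Omega>"
        using tangent_cone_at_infinityD[OF _ x_in x(2) t] by blast
      have "w + s *\<^sub>R c \<in> ball w e" using c(2) s by (simp add: dist_norm)
      then have "\<forall>\<^sub>F k in sequentially. p k \<in> ball w e"
        by (rule topological_tendstoD[OF p(1) open_ball])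
      then have "\<forall>\<^sub>F k in sequentially. p k \<in> cball w e \<and> x k + t k *\<^sub>R p k \<in> \<Omega>"
        by (rule eventually_mono) (use p(2) in auto)
      then show ?thesis using p(1) by blast
    qed
    obtain p where p: "p \<longlonglongrightarrow> w + s *\<^sub>R a" "\<forall>\<^sub>F k in sequentially. p k \<in> A k"
      using eventually_in[OF ab(2)[unfolded T\<^sub>1_def] s_small(1) w1 x1]
      unfolding A_def mem_Collect_eq by (elim exE conjE)
    obtain q where q: "q \<longlonglongrightarrow> w + s *\<^sub>R b" "\<forall>\<^sub>F k in sequentially. q k \<in> B k"
      using eventually_in[OF ab(3)[unfolded T\<^sub>2_def] s_small(2) w2 x2]
      unfolding B_def mem_Collect_eq by (elim exE conjE)
    have "\<forall>\<^sub>F k in sequentially. v k \<bullet> p k \<le> v k \<bullet> q k"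
      using p(2) q(2) by eventually_elim (rule v(2))
    then have ev: "\<forall>\<^sub>F k in sequentially. v (r k) \<bullet> p (r k) \<le> v (r k) \<bullet> q (r k)"
      using filterlim_subseq[OF r(1)] by (rule eventually_compose_filterlim)
    have "v0 \<bullet> (w + s *\<^sub>R a) \<le> v0 \<bullet> (w + s *\<^sub>R b)"
    proof (rule tendsto_le[OF _ _ _ ev])
      show "(\<lambda>k. v (r k) \<bullet> p (r k)) \<longlonglongrightarrow> v0 \<bullet> (w + s *\<^sub>R a)"
        using tendsto_inner[OF r(2) LIMSEQ_subseq_LIMSEQ[OF p(1) r(1)]] by simp
      show "(\<lambda>k. v (r k) \<bullet> q (r k)) \<longlonglongrightarrow> v0 \<bullet> (w + s *\<^sub>R b)"
        using tendsto_inner[OF r(2) LIMSEQ_subseq_LIMSEQ[OF q(1) r(1)]] by simp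
    qed simp
    then have "s * (v0 \<bullet> v0) \<le> 0"
      by (simp add: ab(1) inner_add_right inner_diff_right algebra_simps)
    then show False
      using s v0 by (simp add: mult_le_0_iff dot_square_norm)
  qed
qed

section \<open>Intersection rules for tangent and normal cones at infinity\<close>

theorem proposition3p19:
  fixes \<Omega>\<^sub>1 \<Omega>\<^sub>2 :: "(real ^ 'n::finite) set" and I :: "'n set"
  assumes "closed \<Omega>\<^sub>1" and "convex \<Omega>\<^sub>1"
    and "closed \<Omega>\<^sub>2" and "convex \<Omega>\<^sub>2"
    and "\<Omega>\<^sub>1 \<inter> \<Omega>\<^sub>2 \<noteq> {}" and "\<not> bounded (\<Omega>\<^sub>1 \<inter> \<Omega>\<^sub>2)"
    and "I \<noteq> {}"
    and "normal_cone_at_infinity I \<Omega>\<^sub>1 \<inter> uminus ` normal_cone_at_infinity I \<Omega>\<^sub>2 = {0}"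
  shows "tangent_cone_at_infinity I \<Omega>\<^sub>1 \<inter> tangent_cone_at_infinity I \<Omega>\<^sub>2
           \<subseteq> tangent_cone_at_infinity I (\<Omega>\<^sub>1 \<inter> \<Omega>\<^sub>2)
       \<and> normal_cone_at_infinity I (\<Omega>\<^sub>1 \<inter> \<Omega>\<^sub>2)
           \<subseteq> normal_cone_at_infinity I \<Omega>\<^sub>1 + normal_cone_at_infinity I \<Omega>\<^sub>2"
proof -
  define T\<^sub>1 where "T\<^sub>1 = tangent_cone_at_infinity I \<Omega>\<^sub>1"
  define T\<^sub>2 where "T\<^sub>2 = tangent_cone_at_infinity I \<Omega>\<^sub>2"
  have cones: "convex_cone T\<^sub>1" "convex_cone T\<^sub>2"
    by (simp_all add: T\<^sub>1_def T\<^sub>2_def convex_cone_tangent_cone_at_infinity)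
  have diff: "{a - b |a b. a \<in> T\<^sub>1 \<and> b \<in> T\<^sub>2} = UNIV"
  proof (rule convex_cone_eq_UNIV)
    show "convex_cone {a - b |a b. a \<in> T\<^sub>1 \<and> b \<in> T\<^sub>2}"
      using cones by (rule convex_cone_differences)
    fix v assume *: "\<And>c. c \<in> {a - b |a b. a \<in> T\<^sub>1 \<and> b \<in> T\<^sub>2} \<Longrightarrow> v \<bullet> c \<le> 0"
    have v: "v \<bullet> (a - b) \<le> 0" if "a \<in> T\<^sub>1" "b \<in> T\<^sub>2" for a b
      using * that by blast
    \<comment> \<open>Both cones contain 0, so a functional that is nonpositive on differences is
      polar to the first cone, and its negative is polar to the second.\<close>
    have "v \<in> normal_cone_at_infinity I \<Omega>\<^sub>1"
      using v[of _ 0] convex_cone_contains_0[OF cones(2)]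
      by (auto simp: normal_cone_at_infinity_def T\<^sub>1_def)
    moreover have "- v \<in> normal_cone_at_infinity I \<Omega>\<^sub>2"
      using v[of 0] convex_cone_contains_0[OF cones(1)]
      by (auto simp: normal_cone_at_infinity_def T\<^sub>2_def)
    ultimately have "v \<in> normal_cone_at_infinity I \<Omega>\<^sub>1 \<inter> uminus ` normal_cone_at_infinity I \<Omega>\<^sub>2"
      by force
    then show "v = 0" using assms(8) by simp
  qed
  have tangent: "T\<^sub>1 \<inter> T\<^sub>2 \<subseteq> tangent_cone_at_infinity I (\<Omega>\<^sub>1 \<inter> \<Omega>\<^sub>2)"
    using tangent_cone_at_infinity_Int[of \<Omega>\<^sub>1 \<Omega>\<^sub>2 I] assms diff by (simp add: T\<^sub>1_def T\<^sub>2_def)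
  have "v \<in> normal_cone_at_infinity I \<Omega>\<^sub>1 + normal_cone_at_infinity I \<Omega>\<^sub>2"
    if "v \<in> normal_cone_at_infinity I (\<Omega>\<^sub>1 \<inter> \<Omega>\<^sub>2)" for v
  proof -
    \<comment> \<open>Polarity reverses the inclusion of tangent cones, so \<open>v\<close> is polar
      to \<open>T\<^sub>1 \<inter> T\<^sub>2\<close> and can be split.\<close>
    have "v \<bullet> w \<le> 0" if "w \<in> T\<^sub>1 \<inter> T\<^sub>2" for w
      using \<open>v \<in> normal_cone_at_infinity I (\<Omega>\<^sub>1 \<inter> \<Omega>\<^sub>2)\<close> that tangent
      by (auto simp: normal_cone_at_infinity_def)
    then obtain y where "\<And>a. a \<in> T\<^sub>1 \<Longrightarrow> y \<bullet> a \<le> 0" "\<And>b. b \<in> T\<^sub>2 \<Longrightarrow> (v - y) \<bullet> b \<le> 0"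
      using polar_Int_decomposition[OF cones diff] by blast
    then have "y \<in> normal_cone_at_infinity I \<Omega>\<^sub>1" "v - y \<in> normal_cone_at_infinity I \<Omega>\<^sub>2"
      by (auto simp: normal_cone_at_infinity_def T\<^sub>1_def T\<^sub>2_def)
    then have "y + (v - y) \<in> normal_cone_at_infinity I \<Omega>\<^sub>1 + normal_cone_at_infinity I \<Omega>\<^sub>2"
      by (rule set_plus_intro)
    then show ?thesis by simp
  qed
  then show ?thesis
    using tangent by (auto simp: T\<^sub>1_def T\<^sub>2_def)
qed

end
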